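(* Let $\Phi=B_1|\cdots|B_k$ be a set composition of $[n]$. Then in $\mathrm{NCQSym}$ $$\Delta(P_\Phi)=\sum_{i=0}^kP_{(B_1|\cdots|B_i)^{\downarrow}}\otimes P_{(B_{i+1}|\cdots|B_k)^{\downarrow}} .$$
   Context: A set composition of $[n]$ is an ordered list $\Phi=(B_1,\dots,B_k)=B_1|\cdots|B_k$ of disjoint nonempty sets with union $[n]$. $\mathrm{NCQSym}$ (over $\mathbb{Q}$) is the Hopf algebra of quasisymmetric functions in noncommuting variables, with monomial basis $M_\Phi=\sum x_{a_1}\cdots x_{a_n}$, over all words $(a_1,\dots,a_n)$ of positive integers with exactly $k$ distinct letters such that $B_j=\{i:a_i\text{ is the }j\text{-th smallest distinct letter}\}$. For a list of disjoint nonempty finite sets of positive integers $(C_1,\dots,C_r)$ of total size $m$, its standardization $(C_1|\cdots|C_r)^{\downarrow}$ is the set composition of $[m]$ obtained by applying the order-preserving bijection $\bigcup C_i\to[m]$ (the empty list gives the empty set composition, indexing the unit $1$). The coproduct of $\mathrm{NCQSym}$ is $\Delta(M_\Phi)=\sum_{i=0}^kM_{(B_1|\cdots|B_i)^{\downarrow}}\otimes M_{(B_{i+1}|\cdots|B_k)^{\downarrow}}$. For disjoint nonempty sets of positive integers, $A>_{\widetilde{D}}B$ if and only if $|A|>|B|$, or $|A|=|B|$ and $\min(A)<\min(B)$. For $\Phi=(B_1,\dots,B_k)$, $P_\Phi=\sum_\Psi M_\Psi$, the sum over all set compositions $\Psi$ obtained from $\Phi$ by choosing a subset $I$ of $\{i<k: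 B_i>_{\widetilde D}B_{i+1}\}$ and merging (by union) $B_i$ and $B_{i+1}$ into the same block for every $i\in I$. For example $P_{14|2|3}=M_{14|2|3}+M_{124|3}+M_{14|23}+M_{1234}$. *)

theory Defs
  imports Complex_Main "HOL-Library.Function_Algebras"
begin

definition set_composition :: "nat \<Rightarrow> nat set list \<Rightarrow> bool" where
  "set_composition n \<Phi> \<longleftrightarrow> \<Union>(set \<Phi>) = {1..n} \<and> {} \<notin> set \<Phi> \<and> sorted_wrt disjnt \<Phi>"

definition set_compositions :: "nat set list set" where
  "set_compositions = {\<Phi>. \<exists>n. set_composition n \<Phi>}"

text \<open>Each element of \<open>\<Union>(set Cs)\<close> is replaced by its rank, which is the order-preserving
  bijection onto \<open>{1..m}\<close>.\<close>

definition standardize :: "nat set list \<Rightarrow> nat set list" where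
  "standardize Cs = map (\<lambda>C. (\<lambda>x. card {y \<in> \<Union>(set Cs). y \<le> x}) ` C) Cs"

text \<open>A formal series in the noncommuting variables \<open>x\<^sub>1, x\<^sub>2, \<dots>\<close> is its coefficient function on
  words, that is a function \<open>nat list \<Rightarrow> rat\<close> vanishing on words that contain the letter 0.
  Addition and zero of series are the pointwise ones.\<close>

definition scale_series :: "rat \<Rightarrow> ('a \<Rightarrow> rat) \<Rightarrow> 'a \<Rightarrow> rat" where
  "scale_series c f = (\<lambda>w. c * f w)"

global_interpretation series: vector_space scale_series
  by unfold_locales (auto simp: scale_series_def fun_eq_iff algebra_simps)

text \<open>The list of the sets \<open>{i. a\<^sub>i is the j-th smallest distinct letter}\<close>, in increasing order
  of \<open>j\<close>; positions in a word are counted from 1.\<close>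

definition word_composition :: "nat list \<Rightarrow> nat set list" where
  "word_composition w =
     map (\<lambda>a. {i \<in> {1..length w}. w ! (i - 1) = a}) (sorted_list_of_set (set w))"

definition M :: "nat set list \<Rightarrow> nat list \<Rightarrow> rat" where
  "M \<Phi> w = of_bool (0 \<notin> set w \<and> word_composition w = \<Phi>)"

definition NCQSym :: "(nat list \<Rightarrow> rat) set" where
  "NCQSym = series.span (M ` set_compositions)"

text \<open>\<open>NCQSym \<otimes> NCQSym\<close> is realised inside the functions on pairs of words, through the
  canonical map \<open>f \<otimes> g \<mapsto> ((u, v) \<mapsto> f u * g v)\<close>, which is injective on the tensor product of two
  spaces of functions over a field.\<close>

definition tensor :: "('a \<Rightarrow> rat) \<Rightarrow> ('b \<Rightarrow> rat) \<Rightarrow> 'a \<times> 'b \<Rightarrow> rat" (infixr "\<otimes>" 75) where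
  "f \<otimes> g = (\<lambda>(u, v). f u * g v)"

text \<open>The linear extension to \<open>NCQSym\<close> of the formula on the basis \<open>M\<close>; see \<open>coproduct_M\<close>,
  \<open>coproduct_add\<close> and \<open>coproduct_scale\<close> below. Values outside \<open>NCQSym\<close> are irrelevant.\<close>

definition coproduct :: "(nat list \<Rightarrow> rat) \<Rightarrow> nat list \<times> nat list \<Rightarrow> rat" where
  "coproduct f =
     (\<Sum>\<Phi> | \<Phi> \<in> set_compositions \<and> series.representation (M ` set_compositions) f (M \<Phi>) \<noteq> 0.
        scale_series (series.representation (M ` set_compositions) f (M \<Phi>))
          (\<Sum>i = 0..length \<Phi>. M (standardize (take i \<Phi>)) \<otimes> M (standardize (drop i \<Phi>))))"

definition D_greater :: "nat set \<Rightarrow> nat set \<Rightarrow> bool" where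
  "D_greater A B \<longleftrightarrow> card A > card B \<or> card A = card B \<and> Min A < Min B"

definition mergeable :: "nat set list \<Rightarrow> nat set" where
  "mergeable \<Phi> = {i. Suc i < length \<Phi> \<and> D_greater (\<Phi> ! i) (\<Phi> ! Suc i)}"

text \<open>\<open>merge I \<Phi>\<close> merges the blocks \<open>\<Phi> ! i\<close> and \<open>\<Phi> ! Suc i\<close> for every \<open>i \<in> I\<close>; positions refer
  to the original list and are counted from 0.\<close>

fun merge :: "nat set \<Rightarrow> nat set list \<Rightarrow> nat set list" where
  "merge I [] = []"
| "merge I [A] = [A]"
| "merge I (A # B # \<Phi>) =
     (if 0 \<in> I then merge {i. Suc i \<in> I} ((A \<union> B) # \<Phi>)
      else A # merge {i. Suc i \<in> I} (B # \<Phi>))"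

definition P :: "nat set list \<Rightarrow> nat list \<Rightarrow> rat" where
  "P \<Phi> = (\<Sum>\<Psi> \<in> {merge I \<Phi> | I. I \<subseteq> mergeable \<Phi>}. M \<Psi>)"


lemma word_composition_surj:
  assumes "set_composition n \<Phi>"
  obtains w where "0 \<notin> set w" "word_composition w = \<Phi>"
proof -
  let ?k = "length \<Phi>"
  from assms have un: "\<Union>(set \<Phi>) = {1..n}" and ne: "{} \<notin> set \<Phi>" and dj: "sorted_wrt disjnt \<Phi>"
    by (auto simp: set_composition_def)
  have dj': "i = j" if "i < ?k" "j < ?k" "x \<in> \<Phi> ! i" "x \<in> \<Phi> ! j" for i j x
    using dj that unfolding sorted_wrt_iff_nth_less disjnt_def
    by (metis disjoint_iff linorder_neqE_nat)
  define p where "p x = (THE j. j < ?k \<and> x \<in> \<Phi> ! j)" for x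
  have p: "p x = j" if "j < ?k" "x \<in> \<Phi> ! j" for x j
    unfolding p_def using that dj' by blast
  have ex: "\<exists>j<?k. x \<in> \<Phi> ! j" if "x \<in> {1..n}" for x
    using that un by (metis UnionE in_set_conv_nth)
  define w where "w = map (\<lambda>i. Suc (p (Suc i))) [0..<n]"
  have sw: "set w = {Suc 0..<Suc ?k}"
  proof (intro set_eqI iffI)
    fix a assume "a \<in> set w"
    then obtain i where "i < n" "a = Suc (p (Suc i))" by (auto simp: w_def)
    moreover obtain j where "j < ?k" "Suc i \<in> \<Phi> ! j" using ex[of "Suc i"] \<open>i < n\<close> by auto
    ultimately show "a \<in> {Suc 0..<Suc ?k}" using p by auto
  next
    fix a assume a: "a \<in> {Suc 0..<Suc ?k}"
    then obtain j where j: "a = Suc j" "j < ?k" by (cases a) auto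
    then have "\<Phi> ! j \<noteq> {}" using ne by (metis nth_mem)
    then obtain x where x: "x \<in> \<Phi> ! j" by auto
    then have "x \<in> {1..n}" using un j by (metis UnionI nth_mem)
    then show "a \<in> set w" using j x p[OF j(2) x]
      by (auto simp: w_def image_iff intro!: bexI[of _ "x - 1"])
  qed
  have nth: "w ! (i - 1) = Suc (p i)" if "i \<in> {1..n}" for i
    using that by (auto simp: w_def)
  have len: "length w = n" by (simp add: w_def)
  have "word_composition w = map (\<lambda>a. {i \<in> {1..n}. w ! (i - 1) = a}) [Suc 0..<Suc ?k]"
    unfolding word_composition_def sw len by (simp only: sorted_list_of_set_range)
  also have "\<dots> = \<Phi>"
  proof (rule nth_equalityI)
    fix j assume "j < length (map (\<lambda>a. {i \<in> {1..n}. w ! (i - 1) = a}) [Suc 0..<Suc ?k])"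
    then have j: "j < ?k" by (simp del: upt_Suc)
    then have "map (\<lambda>a. {i \<in> {1..n}. w ! (i - 1) = a}) [Suc 0..<Suc ?k] ! j
        = {i \<in> {1..n}. w ! (i - 1) = Suc j}"
      by (subst nth_map) (simp_all del: upt_Suc)
    also have "\<dots> = {i \<in> {1..n}. p i = j}" using nth by auto
    also have "\<dots> = \<Phi> ! j"
    proof (intro set_eqI iffI)
      fix x assume "x \<in> {i \<in> {1..n}. p i = j}"
      then show "x \<in> \<Phi> ! j" using ex[of x] p by auto
    next
      fix x assume x: "x \<in> \<Phi> ! j"
      then have "x \<in> {1..n}" using un j by (metis UnionI nth_mem)
      then show "x \<in> {i \<in> {1..n}. p i = j}" using p[OF j x] by auto
    qed
    finally show "map (\<lambda>a. {i \<in> {1..n}. w ! (i - 1) = a}) [Suc 0..<Suc ?k] ! j = \<Phi> ! j" .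
  qed (simp del: upt_Suc)
  finally have "word_composition w = \<Phi>" .
  moreover have "0 \<notin> set w" by (auto simp: w_def)
  ultimately show ?thesis using that by blast
qed

lemma inj_on_M: "inj_on M set_compositions"
proof (rule inj_onI)
  fix \<Phi> \<Psi> assume "\<Phi> \<in> set_compositions" and eq: "M \<Phi> = M \<Psi>"
  then obtain w where "0 \<notin> set w" "word_composition w = \<Phi>"
    unfolding set_compositions_def using word_composition_surj by blast
  then show "\<Phi> = \<Psi>" using fun_cong[OF eq, of w] by (auto simp: M_def split: if_splits)
qed

lemma sum_series_apply: "(\<Sum>x\<in>A. f x) w = (\<Sum>x\<in>A. (f x :: 'a \<Rightarrow> rat) w)"
  by (induction A rule: infinite_finite_induct) auto

lemma independent_M: "series.independent (M ` set_compositions)"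
proof
  assume "series.dependent (M ` set_compositions)"
  then obtain t u b where t: "finite t" "t \<subseteq> M ` set_compositions"
    and s: "(\<Sum>v\<in>t. scale_series (u v) v) = 0" and b: "b \<in> t" "u b \<noteq> 0"
    unfolding series.dependent_explicit by blast
  obtain \<Phi> where \<Phi>: "\<Phi> \<in> set_compositions" "b = M \<Phi>" using t b by blast
  then obtain w where w: "0 \<notin> set w" "word_composition w = \<Phi>"
    unfolding set_compositions_def using word_composition_surj by blast
  have ev: "v w = of_bool (v = b)" if "v \<in> t" for v
  proof -
    from that t obtain \<Psi> where "\<Psi> \<in> set_compositions" "v = M \<Psi>" by blast
    then show ?thesis using \<Phi> w inj_on_M by (auto simp: M_def inj_on_eq_iff)
  qed
  have "(\<Sum>v\<in>t. scale_series (u v) v) w = (\<Sum>v\<in>t. if v = b then u b else 0)"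
    unfolding sum_series_apply scale_series_def by (intro sum.cong refl) (simp add: ev)
  also have "\<dots> = u b" using t b by simp
  finally show False using s b by simp
qed

lemma coproduct_M:
  assumes "\<Phi> \<in> set_compositions"
  shows "coproduct (M \<Phi>) =
    (\<Sum>i = 0..length \<Phi>. M (standardize (take i \<Phi>)) \<otimes> M (standardize (drop i \<Phi>)))"
proof -
  have rep: "series.representation (M ` set_compositions) (M \<Phi>) = (\<lambda>v. if v = M \<Phi> then 1 else 0)"
    using series.representation_basis[OF independent_M, of "M \<Phi>"] assms by auto
  have "{\<Psi>. \<Psi> \<in> set_compositions \<and> series.representation (M ` set_compositions) (M \<Phi>) (M \<Psi>) \<noteq> 0}
      = {\<Phi>}"
    using assms inj_on_M by (auto simp: rep inj_on_eq_iff)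
  then show ?thesis unfolding coproduct_def by (simp add: rep)
qed

lemma finite_support:
  "finite {\<Phi>. \<Phi> \<in> set_compositions \<and> series.representation (M ` set_compositions) f (M \<Phi>) \<noteq> 0}"
proof (rule finite_imageD)
  show "finite (M ` {\<Phi>. \<Phi> \<in> set_compositions \<and>
      series.representation (M ` set_compositions) f (M \<Phi>) \<noteq> 0})"
    by (rule finite_subset[OF _ series.finite_representation[of "M ` set_compositions" f]]) auto
  show "inj_on M {\<Phi>. \<Phi> \<in> set_compositions \<and>
      series.representation (M ` set_compositions) f (M \<Phi>) \<noteq> 0}"
    by (rule inj_on_subset[OF inj_on_M]) auto
qed

lemma coproduct_superset:
  assumes "finite S" "S \<subseteq> set_compositions"
    "{\<Phi>. \<Phi> \<in> set_compositions \<and> series.representation (M ` set_compositions) f (M \<Phi>) \<noteq> 0} \<subseteq> S"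
  shows "coproduct f =
     (\<Sum>\<Phi>\<in>S. scale_series (series.representation (M ` set_compositions) f (M \<Phi>))
        (\<Sum>i = 0..length \<Phi>. M (standardize (take i \<Phi>)) \<otimes> M (standardize (drop i \<Phi>))))"
  unfolding coproduct_def using assms
  by (intro sum.mono_neutral_left) auto

lemma coproduct_add:
  assumes "f \<in> NCQSym" "g \<in> NCQSym"
  shows "coproduct (f + g) = coproduct f + coproduct g"
proof -
  let ?R = "series.representation (M ` set_compositions)"
  let ?S = "\<lambda>f. {\<Phi>. \<Phi> \<in> set_compositions \<and> ?R f (M \<Phi>) \<noteq> 0}"
  have add: "?R (f + g) v = ?R f v + ?R g v" for v
    using series.representation_add[OF independent_M] assms by (simp add: NCQSym_def)
  have fin: "finite (?S f \<union> ?S g)" using finite_support by blast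
  have "coproduct h = (\<Sum>\<Phi>\<in>?S f \<union> ?S g. scale_series (?R h (M \<Phi>))
     (\<Sum>i = 0..length \<Phi>. M (standardize (take i \<Phi>)) \<otimes> M (standardize (drop i \<Phi>))))"
    if "h \<in> {f, g, f + g}" for h
    using that by (intro coproduct_superset fin) (auto simp: add)
  then show ?thesis by (simp add: add series.scale_left_distrib sum.distrib)
qed

lemma coproduct_scale:
  assumes "f \<in> NCQSym"
  shows "coproduct (scale_series c f) = scale_series c (coproduct f)"
proof -
  let ?R = "series.representation (M ` set_compositions)"
  let ?S = "{\<Phi>. \<Phi> \<in> set_compositions \<and> ?R f (M \<Phi>) \<noteq> 0}"
  have sc: "?R (scale_series c f) v = c * ?R f v" for v
    using series.representation_scale[OF independent_M] assms by (simp add: NCQSym_def)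
  have "coproduct (scale_series c f) = (\<Sum>\<Phi>\<in>?S. scale_series (?R (scale_series c f) (M \<Phi>))
     (\<Sum>i = 0..length \<Phi>. M (standardize (take i \<Phi>)) \<otimes> M (standardize (drop i \<Phi>))))"
    by (intro coproduct_superset finite_support) (auto simp: sc)
  also have "\<dots> = scale_series c (coproduct f)"
    unfolding coproduct_def sc series.scale_sum_right by simp
  finally show ?thesis .
qed

lemma set_composition_merge:
  "set_composition n \<Phi> \<Longrightarrow> set_composition n (merge I \<Phi>)"
proof -
  have *: "\<Union>(set (merge I \<Phi>)) = \<Union>(set \<Phi>) \<and> {} \<notin> set (merge I \<Phi>) \<and> sorted_wrt disjnt (merge I \<Phi>)"
    if "{} \<notin> set \<Phi>" "sorted_wrt disjnt \<Phi>"
    using that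
  proof (induction I \<Phi> rule: merge.induct)
    case (3 I A B \<Phi>)
    show ?case
    proof (cases "0 \<in> I")
      case True
      then show ?thesis using 3 by (auto simp: disjnt_Un1)
    next
      case False
      have IH: "\<Union>(set (merge {i. Suc i \<in> I} (B # \<Phi>))) = \<Union>(set (B # \<Phi>))"
        "{} \<notin> set (merge {i. Suc i \<in> I} (B # \<Phi>))"
        "sorted_wrt disjnt (merge {i. Suc i \<in> I} (B # \<Phi>))"
        using 3 False by auto
      have "disjnt A (\<Union>(set (B # \<Phi>)))" using 3(4) by (auto simp: disjnt_def)
      then have "\<forall>C \<in> set (merge {i. Suc i \<in> I} (B # \<Phi>)). disjnt A C"
        unfolding IH(1)[symmetric] by (auto simp: disjnt_def)
      then show ?thesis using IH False 3(3) by auto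
    qed
  qed auto
  then show "set_composition n \<Phi> \<Longrightarrow> set_composition n (merge I \<Phi>)"
    by (auto simp: set_composition_def)
qed

lemma P_in_NCQSym: "set_composition n \<Phi> \<Longrightarrow> P \<Phi> \<in> NCQSym"
  unfolding P_def NCQSym_def
  by (rule series.span_sum, rule series.span_base)
    (auto simp: set_compositions_def dest: set_composition_merge)

end

theory Submission
  imports Defs
begin

text \<open>Cutting a merged composition \<open>\<Psi>\<close> of \<open>\<Phi>\<close> between two blocks is the same as cutting \<open>\<Phi>\<close> at a
  place where no merge happens and then merging the two parts independently. Hence the pairs
  \<open>(\<Psi>, i)\<close> indexing \<open>\<Delta>(P\<^sub>\<Phi>)\<close> correspond to the triples \<open>(j, \<Psi>\<^sub>1, \<Psi>\<^sub>2)\<close> indexing the right-hand side.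
  Standardization commutes with merging and respects \<open>D_greater\<close>, since it applies a
  monotone injection.\<close>

definition merges :: "nat set list \<Rightarrow> nat set list set" where
  "merges \<Phi> = {merge I \<Phi> | I. I \<subseteq> mergeable \<Phi>}"

lemma finite_merges: "finite (merges \<Phi>)"
proof -
  have "finite (mergeable \<Phi>)"
    by (rule finite_subset[of _ "{..<length \<Phi>}"]) (auto simp: mergeable_def)
  moreover have "merges \<Phi> = (\<lambda>I. merge I \<Phi>) ` Pow (mergeable \<Phi>)"
    by (auto simp: merges_def)
  ultimately show ?thesis by simp
qed

lemma Union_set_merge: "\<Union>(set (merge I \<Phi>)) = \<Union>(set \<Phi>)"
  by (induction I \<Phi> rule: merge.induct) auto

lemma merge_cong:
  assumes "\<And>i. Suc i < length \<Phi> \<Longrightarrow> i \<in> I \<longleftrightarrow> i \<in> J"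
  shows "merge I \<Phi> = merge J \<Phi>"
  using assms by (induction I \<Phi> arbitrary: J rule: merge.induct) auto

text \<open>The index \<open>length \<Phi> - 1\<close> is the junction gap; if it is unmerged, the
  recursion never carries a block across. The two empty cases have no junction.\<close>

lemma merge_append:
  assumes "\<Phi> = [] \<or> \<Psi> = [] \<or> length \<Phi> - 1 \<notin> I"
  shows "merge I (\<Phi> @ \<Psi>) = merge I \<Phi> @ merge {i. i + length \<Phi> \<in> I} \<Psi>"
  using assms
proof (induction I \<Phi> rule: merge.induct)
  case (2 I A)
  then show ?case by (cases \<Psi>) auto
qed auto

text \<open>Each merged block absorbs a run of consecutive blocks; \<open>j\<close> counts the
  original blocks absorbed by the first \<open>i\<close> merged ones, and this initial segment ends
  at an unmerged gap or at an end of the list.\<close>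

lemma merge_split:
  assumes "i \<le> length (merge I \<Phi>)"
  obtains j where "j \<le> length \<Phi>" "j = 0 \<or> j = length \<Phi> \<or> j - 1 \<notin> I"
    "length (merge I (take j \<Phi>)) = i"
proof -
  have "\<exists>j\<le>length \<Phi>. (j = 0 \<or> j = length \<Phi> \<or> j - 1 \<notin> I) \<and> length (merge I (take j \<Phi>)) = i"
    using assms
  proof (induction I \<Phi> arbitrary: i rule: merge.induct)
    case (2 I A)
    then show ?case by (cases i) (auto intro: exI[of _ 0] exI[of _ 1])
  next
    case (3 I A B \<Phi>)
    show ?case
    proof (cases i)
      case 0
      then show ?thesis by auto
    next
      case (Suc i')
      show ?thesis
      proof (cases "0 \<in> I")
        case True
        obtain j where j: "j \<le> length ((A \<union> B) # \<Phi>)"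
          "j = 0 \<or> j = length ((A \<union> B) # \<Phi>) \<or> j - 1 \<notin> {i. Suc i \<in> I}"
          "length (merge {i. Suc i \<in> I} (take j ((A \<union> B) # \<Phi>))) = i"
          using 3(1)[OF True, of i] 3(3) True by auto
        then obtain j' where "j = Suc j'" using Suc by (cases j) auto
        \<comment> \<open>The first \<open>j \<ge> 1\<close> entries include
          \<open>A \<union> B\<close>, which stands for two original blocks, hence the cut
          \<open>Suc j\<close>.\<close>
        then show ?thesis using j True by (intro exI[of _ "Suc j"]) auto
      next
        case False
        obtain j where "j \<le> length (B # \<Phi>)"
          "j = 0 \<or> j = length (B # \<Phi>) \<or> j - 1 \<notin> {i. Suc i \<in> I}"
          "length (merge {i. Suc i \<in> I} (take j (B # \<Phi>))) = i'"
          using 3(2)[OF False, of i'] 3(3) False Suc by auto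
        \<comment> \<open>\<open>A\<close> stays a block of its own and accounts for one of the
          \<open>i\<close> blocks. If \<open>j = 0\<close>, the cut falls at gap 0, which is outside
          \<open>I\<close>.\<close>
        then show ?thesis using False Suc by (intro exI[of _ "Suc j"]) (cases j; auto)
      qed
    qed
  qed auto
  then show ?thesis using that by blast
qed

text \<open>No merge crosses the cut \<open>j\<close> found by \<open>merge_split\<close>, so
  \<open>I\<close> falls into the indices below the cut and those above it, shifted down by
  \<open>j\<close>.\<close>

lemma merges_split:
  assumes "\<Psi> \<in> merges \<Phi>" "i \<le> length \<Psi>"
  obtains j where "j \<le> length \<Phi>" "take i \<Psi> \<in> merges (take j \<Phi>)" "drop i \<Psi> \<in> merges (drop j \<Phi>)"
proof -
  obtain I where I: "I \<subseteq> mergeable \<Phi>" "\<Psi> = merge I \<Phi>"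
    using assms(1) by (auto simp: merges_def)
  obtain j where j: "j \<le> length \<Phi>" "j = 0 \<or> j = length \<Phi> \<or> j - 1 \<notin> I"
    "length (merge I (take j \<Phi>)) = i"
    using merge_split assms(2) I(2) by blast
  have "\<Psi> = merge I (take j \<Phi>) @ merge {k. k + j \<in> I} (drop j \<Phi>)"
    using merge_append[of "take j \<Phi>" "drop j \<Phi>" I] I j by (auto simp: min_absorb2)
  then have "take i \<Psi> = merge I (take j \<Phi>)" "drop i \<Psi> = merge {k. k + j \<in> I} (drop j \<Phi>)"
    using j(3) by auto
  moreover have "merge I (take j \<Phi>) = merge {k \<in> I. Suc k < j} (take j \<Phi>)"
    by (rule merge_cong) auto
  moreover have "{k \<in> I. Suc k < j} \<subseteq> mergeable (take j \<Phi>)"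
    using I(1) j(1) by (auto simp: mergeable_def)
  moreover have "{k. k + j \<in> I} \<subseteq> mergeable (drop j \<Phi>)"
    using I(1) j(1) by (auto simp: mergeable_def add.commute)
  ultimately have "take i \<Psi> \<in> merges (take j \<Phi>)" "drop i \<Psi> \<in> merges (drop j \<Phi>)"
    unfolding merges_def by auto
  then show ?thesis using that j(1) by blast
qed

text \<open>Shifting the second index set by \<open>length \<Phi>1\<close> leaves the junction gap,
  if there is one, free: members of \<open>I1\<close> are smaller than it, shifted members of
  \<open>I2\<close> are larger.\<close>

lemma merges_append:
  assumes "\<Psi>1 \<in> merges \<Phi>1" "\<Psi>2 \<in> merges \<Phi>2"
  shows "\<Psi>1 @ \<Psi>2 \<in> merges (\<Phi>1 @ \<Phi>2)"
proof -
  obtain I1 I2 where I: "I1 \<subseteq> mergeable \<Phi>1" "\<Psi>1 = merge I1 \<Phi>1" "I2 \<subseteq> mergeable \<Phi>2" "\<Psi>2 = merge I2 \<Phi>2"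
    using assms by (auto simp: merges_def)
  let ?I = "I1 \<union> (\<lambda>i. i + length \<Phi>1) ` I2"
  have lt: "Suc i < length \<Phi>1" if "i \<in> I1" for i
    using I(1) that by (auto simp: mergeable_def)
  have I2_eq: "{i. i + length \<Phi>1 \<in> ?I} = I2" using lt by fastforce
  have I1_eq: "merge ?I \<Phi>1 = merge I1 \<Phi>1" by (rule merge_cong) auto
  have "\<Phi>1 = [] \<or> \<Phi>2 = [] \<or> length \<Phi>1 - 1 \<notin> ?I"
    using lt by (cases \<Phi>1) (auto dest: lt)
  then have "merge ?I (\<Phi>1 @ \<Phi>2) = \<Psi>1 @ \<Psi>2"
    by (simp only: merge_append I2_eq I1_eq I)
  moreover have "?I \<subseteq> mergeable (\<Phi>1 @ \<Phi>2)"
    using I by (auto simp: mergeable_def nth_append)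
  ultimately show ?thesis unfolding merges_def by (metis (mono_tags, lifting) mem_Collect_eq)
qed

text \<open>Block \<open>l\<close> is nonempty and disjoint from the blocks before it, so it
  enlarges the union. This recovers a cut from the set of elements before it.\<close>

lemma Union_take_inj:
  assumes "{} \<notin> set \<Phi>" "sorted_wrt disjnt \<Phi>" "j \<le> length \<Phi>" "k \<le> length \<Phi>"
    "\<Union>(set (take j \<Phi>)) = \<Union>(set (take k \<Phi>))"
  shows "j = k"
proof -
  have False if l: "l < m" "m \<le> length \<Phi>" "\<Union>(set (take m \<Phi>)) = \<Union>(set (take l \<Phi>))" for l m
  proof -
    have "\<Phi> ! l \<in> set (take m \<Phi>)" using l by (auto simp: in_set_conv_nth intro!: exI[of _ l])
    moreover have "\<Phi> ! l \<noteq> {}" using assms(1) l by (metis nth_mem order_less_le_trans)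
    ultimately obtain x where x: "x \<in> \<Phi> ! l" "x \<in> \<Union>(set (take l \<Phi>))" using l(3) by blast
    then obtain p where p: "p < l" "x \<in> \<Phi> ! p" using l by (auto simp: in_set_conv_nth)
    then show False using assms(2) x(1) l(1,2) p unfolding sorted_wrt_iff_nth_less disjnt_def by fastforce
  qed
  then show ?thesis using assms by (metis linorder_neqE_nat)
qed

lemma bij_betw_merges:
  assumes "{} \<notin> set \<Phi>" "sorted_wrt disjnt \<Phi>"
  shows "bij_betw (\<lambda>(j, \<Psi>1, \<Psi>2). (\<Psi>1 @ \<Psi>2, length \<Psi>1))
    (SIGMA j:{0..length \<Phi>}. merges (take j \<Phi>) \<times> merges (drop j \<Phi>))
    (SIGMA \<Psi>:merges \<Phi>. {0..length \<Psi>})" (is "bij_betw ?f ?A ?B")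
proof (rule bij_betw_imageI)
  have U: "\<Union>(set \<Psi>) = \<Union>(set X)" if "\<Psi> \<in> merges X" for \<Psi> X
    using that Union_set_merge unfolding merges_def by blast
  \<comment> \<open>The image pair determines \<open>\<Psi>1\<close> and \<open>\<Psi>2\<close>; the
    cut is read off the union of \<open>\<Psi>1\<close>, since merging preserves unions.\<close>
  show "inj_on ?f ?A"
  proof (rule inj_onI, clarsimp)
    fix j k \<Psi>1 \<Psi>2 assume "j \<le> length \<Phi>" "k \<le> length \<Phi>"
      "\<Psi>1 \<in> merges (take j \<Phi>)" "\<Psi>1 \<in> merges (take k \<Phi>)"
    then show "j = k" using Union_take_inj[OF assms] U by metis
  qed
  show "?f ` ?A = ?B"
  proof (intro equalityI subsetI)
    fix x assume "x \<in> ?f ` ?A"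
    then show "x \<in> ?B" using merges_append by fastforce
  next
    fix x assume "x \<in> ?B"
    then obtain \<Psi> i where x: "x = (\<Psi>, i)" "\<Psi> \<in> merges \<Phi>" "i \<le> length \<Psi>" by auto
    then obtain j where "j \<le> length \<Phi>" "take i \<Psi> \<in> merges (take j \<Phi>)" "drop i \<Psi> \<in> merges (drop j \<Phi>)"
      using merges_split by blast
    then show "x \<in> ?f ` ?A" using x
      by (intro image_eqI[of _ _ "(j, take i \<Psi>, drop i \<Psi>)"]) auto
  qed
qed

lemma merge_map_image: "merge I (map ((`) r) \<Phi>) = map ((`) r) (merge I \<Phi>)"
  by (induction I \<Phi> rule: merge.induct) (auto simp flip: image_Un)

text \<open>\<open>D_greater\<close> compares only sizes and minima: injectivity preserves the
  former and monotonicity commutes with the latter. Injectivity is asked only on the underlying set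
  because a rank function is constant between consecutive elements.\<close>

lemma mergeable_map_image:
  assumes "mono r" "inj_on r (\<Union>(set \<Phi>))" "{} \<notin> set \<Phi>" "finite (\<Union>(set \<Phi>))"
  shows "mergeable (map ((`) r) \<Phi>) = mergeable \<Phi>"
proof -
  have "D_greater (r ` A) (r ` B) \<longleftrightarrow> D_greater A B" if "A \<in> set \<Phi>" "B \<in> set \<Phi>" for A B
  proof -
    have sub: "A \<subseteq> \<Union>(set \<Phi>)" "B \<subseteq> \<Union>(set \<Phi>)" using that by auto
    then have fin: "finite A" "finite B" using assms(4) finite_subset by auto
    have ne: "A \<noteq> {}" "B \<noteq> {}" using that assms(3) by auto
    have "card (r ` A) = card A" "card (r ` B) = card B"
      using sub assms(2) by (auto intro!: card_image elim: inj_on_subset)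
    moreover have "Min (r ` A) = r (Min A)" "Min (r ` B) = r (Min B)"
      using mono_Min_commute[OF assms(1)] fin ne by auto
    moreover have "Min A \<in> \<Union>(set \<Phi>)" "Min B \<in> \<Union>(set \<Phi>)"
      using sub fin ne Min_in by blast+
    then have "r (Min A) < r (Min B) \<longleftrightarrow> Min A < Min B"
      using monoD[OF assms(1), of "Min A" "Min B"] monoD[OF assms(1), of "Min B" "Min A"]
        inj_on_eq_iff[OF assms(2), of "Min A" "Min B"]
      by linarith
    ultimately show ?thesis by (simp add: D_greater_def)
  qed
  then show ?thesis by (auto simp: mergeable_def)
qed

lemma P_standardize:
  assumes "{} \<notin> set \<Phi>" "finite (\<Union>(set \<Phi>))"
  shows "P (standardize \<Phi>) = (\<Sum>\<Psi>\<in>merges \<Phi>. M (standardize \<Psi>))"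
proof -
  let ?U = "\<Union>(set \<Phi>)"
  define r where "r x = card {y \<in> ?U. y \<le> x}" for x
  have mono: "mono r" unfolding r_def using assms(2) by (intro monoI card_mono) auto
  \<comment> \<open>\<open>y\<close> itself is counted in its own rank but not in that of
    \<open>x\<close>.\<close>
  have "r x < r y" if "x < y" "y \<in> ?U" for x y
    unfolding r_def using assms(2) that
    by (intro psubset_card_mono psubsetI) (auto dest!: equalityD2)
  then have inj: "inj_on r ?U" by (intro linorder_inj_onI') (metis less_not_refl)
  \<comment> \<open>Ranks depend only on the union of the blocks, so this single \<open>r\<close>
    standardizes \<open>\<Phi>\<close> and all its merges.\<close>
  have std: "standardize \<Psi> = map ((`) r) \<Psi>" if "\<Union>(set \<Psi>) = ?U" for \<Psi>
    unfolding standardize_def that r_def by simp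
  have U: "\<Union>(set \<Psi>) = ?U" if "\<Psi> \<in> merges \<Phi>" for \<Psi>
    using that Union_set_merge unfolding merges_def by blast
  have "merges (standardize \<Phi>) = map ((`) r) ` merges \<Phi>"
    unfolding std[OF refl] merges_def mergeable_map_image[OF mono inj assms] merge_map_image
    by auto
  \<comment> \<open>Reindexing the sum requires that no two merges collapse under
    standardization.\<close>
  moreover have "inj_on (map ((`) r)) (merges \<Phi>)"
  proof (rule inj_on_subset)
    show "inj_on (map ((`) r)) (lists (Pow ?U))"
      using inj by (intro inj_on_map_lists inj_on_image_Pow)
    show "merges \<Phi> \<subseteq> lists (Pow ?U)" using U by (auto simp: in_lists_conv_set)
  qed
  ultimately have "P (standardize \<Phi>) = (\<Sum>\<Psi>\<in>merges \<Phi>. M (map ((`) r) \<Psi>))"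
    unfolding P_def merges_def[symmetric] by (simp add: sum.reindex)
  then show ?thesis by (simp add: std U)
qed

lemma coproduct_sum_M:
  assumes "finite S" "S \<subseteq> set_compositions"
  shows "coproduct (\<Sum>\<Psi>\<in>S. M \<Psi>) = (\<Sum>\<Psi>\<in>S. coproduct (M \<Psi>))"
  using assms
proof (induction S rule: finite_induct)
  case empty
  have "(0 :: nat list \<Rightarrow> rat) \<in> NCQSym" by (simp add: NCQSym_def series.span_zero)
  \<comment> \<open>Scaling by 0 forces the coproduct of the empty sum to vanish.\<close>
  from coproduct_scale[OF this, of 0] show ?case by (simp only: series.scale_zero_left sum.empty)
next
  case (insert \<Psi> S)
  then have mem: "M \<Psi> \<in> NCQSym" "(\<Sum>\<Psi>\<in>S. M \<Psi>) \<in> NCQSym"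
    by (auto simp: NCQSym_def intro: series.span_sum series.span_base)
  have "coproduct (\<Sum>\<Psi>\<in>S. M \<Psi>) = (\<Sum>\<Psi>\<in>S. coproduct (M \<Psi>))" using insert by simp
  then show ?case unfolding sum.insert[OF insert.hyps] coproduct_add[OF mem] by (rule arg_cong)
qed

lemma tensor_sum:
  "(\<Sum>x\<in>A. f x) \<otimes> (\<Sum>y\<in>B. g y) = (\<Sum>(x, y)\<in>A \<times> B. f x \<otimes> g y)"
  by (auto simp: fun_eq_iff tensor_def sum_series_apply sum_product sum.cartesian_product
      intro!: sum.cong)

theorem theorem10:
  fixes n :: nat and \<Phi> :: "nat set list"
  assumes "set_composition n \<Phi>"
  shows "coproduct (P \<Phi>) =
    (\<Sum>i = 0..length \<Phi>. P (standardize (take i \<Phi>)) \<otimes> P (standardize (drop i \<Phi>)))"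
proof -
  let ?T = "\<lambda>\<Psi>1 \<Psi>2. M (standardize \<Psi>1) \<otimes> M (standardize \<Psi>2)"
  have \<Phi>: "{} \<notin> set \<Phi>" "sorted_wrt disjnt \<Phi>" "finite (\<Union>(set \<Phi>))"
    using assms by (auto simp: set_composition_def)
  have sc: "merges \<Phi> \<subseteq> set_compositions"
    using set_composition_merge[OF assms] by (auto simp: merges_def set_compositions_def)
  have part: "P (standardize X) = (\<Sum>\<Psi>\<in>merges X. M (standardize \<Psi>))" if "set X \<subseteq> set \<Phi>" for X
    using that \<Phi> by (intro P_standardize) (auto intro: finite_subset[OF Union_mono])
  have "coproduct (P \<Phi>) = (\<Sum>\<Psi>\<in>merges \<Phi>. coproduct (M \<Psi>))"
    unfolding P_def merges_def[symmetric] by (rule coproduct_sum_M[OF finite_merges sc])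
  also have "\<dots> = (\<Sum>\<Psi>\<in>merges \<Phi>. \<Sum>i = 0..length \<Psi>. ?T (take i \<Psi>) (drop i \<Psi>))"
    using sc by (intro sum.cong refl coproduct_M) auto
  also have "\<dots> = (\<Sum>(\<Psi>, i)\<in>(SIGMA \<Psi>:merges \<Phi>. {0..length \<Psi>}). ?T (take i \<Psi>) (drop i \<Psi>))"
    by (rule sum.Sigma) (auto simp: finite_merges)
  \<comment> \<open>Reindexing by the bijection: cutting \<open>\<Psi>1 @ \<Psi>2\<close> at
    \<open>length \<Psi>1\<close> returns the two parts.\<close>
  also have "\<dots> = (\<Sum>(j, \<Psi>1, \<Psi>2)\<in>(SIGMA j:{0..length \<Phi>}. merges (take j \<Phi>) \<times> merges (drop j \<Phi>)).
      ?T \<Psi>1 \<Psi>2)"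
    by (subst sum.reindex_bij_betw[OF bij_betw_merges[OF \<Phi>(1,2)], symmetric])
      (auto intro!: sum.cong)
  also have "\<dots> = (\<Sum>j = 0..length \<Phi>. \<Sum>(\<Psi>1, \<Psi>2)\<in>merges (take j \<Phi>) \<times> merges (drop j \<Phi>). ?T \<Psi>1 \<Psi>2)"
    by (subst sum.Sigma) (auto simp: finite_merges)
  \<comment> \<open>For fixed \<open>j\<close>, bilinearity factors the double sum into two sums,
    and \<open>part\<close> identifies each as a standardized \<open>P\<close>.\<close>
  also have "\<dots> = (\<Sum>j = 0..length \<Phi>. P (standardize (take j \<Phi>)) \<otimes> P (standardize (drop j \<Phi>)))"
    by (simp add: part set_take_subset set_drop_subset tensor_sum)
  finally show ?thesis .
qed

end
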